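(* Let $n$ be a positive integer. The quantum double $D(D_n)$ has an irreducible complex representation of dimension three if and only if $n=3$ or $n=6$.
   Context: $D_n$ is the dihedral group of order $2n$ with generators $\sigma,\tau$ satisfying $\sigma^n=e$, $\tau^2=e$, $\tau\sigma=\sigma^{n-1}\tau$. For a finite group $G$, the quantum double $D(G)$ is the $|G|^2$-dimensional complex associative algebra with basis $\{gh^*: g,h\in G\}$, where the elements $g\in G$ multiply as in $G$, the dual elements satisfy $g^*h^*=\delta(g,h)h^*$, and $h^*g=g\,(g^{-1}hg)^*$ for $g,h\in G$. Here $g\in G$ is identified with $\sum_{h\in G}gh^*$ and $h^*$ with $eh^*$; the unit is $e=\sum_{h\in G}h^*$. *)

theory Defs
  imports "HOL-Analysis.Analysis" "HOL-Algebra.Algebra"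
begin

section \<open>Dihedral groups\<close>

text \<open>The pair \<open>(i, s)\<close> stands for \<open>\<sigma>\<^sup>i\<close> if \<open>s\<close> is false and for \<open>\<sigma>\<^sup>i\<tau>\<close> if \<open>s\<close> is true;
  the product is forced by \<open>\<tau>\<sigma>\<^sup>k = \<sigma>\<^bsup>-k\<^esup>\<tau>\<close>.\<close>

definition dihedral_group :: "nat \<Rightarrow> (int \<times> bool) monoid" where
  "dihedral_group n =
     \<lparr> carrier = {0..<int n} \<times> UNIV,
       mult = (\<lambda>(i, s) (k, t). ((if s then i - k else i + k) mod int n, s \<noteq> t)),
       one = (0, False) \<rparr>"

text \<open>The reduction modulo \<open>n\<close> matters only for \<open>n = 1\<close>, where \<open>\<sigma>\<close> is trivial.\<close>

definition dihedral_rot :: "nat \<Rightarrow> int \<times> bool" where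
  "dihedral_rot n = (1 mod int n, False)"

definition dihedral_refl :: "int \<times> bool" where
  "dihedral_refl = (0, True)"

lemma group_dihedral_group:
  assumes "n > 0"
  shows "group (dihedral_group n)"
proof (rule groupI)
  fix x y z
  assume "x \<in> carrier (dihedral_group n)" "y \<in> carrier (dihedral_group n)"
    "z \<in> carrier (dihedral_group n)"
  then show "x \<otimes>\<^bsub>dihedral_group n\<^esub> y \<otimes>\<^bsub>dihedral_group n\<^esub> z =
      x \<otimes>\<^bsub>dihedral_group n\<^esub> (y \<otimes>\<^bsub>dihedral_group n\<^esub> z)"
    by (auto simp: dihedral_group_def mod_simps algebra_simps split: prod.splits)
next
  fix x assume x: "x \<in> carrier (dihedral_group n)"
  obtain i s where xis: "x = (i, s)" by fastforce
  have "(if s then i else (- i) mod int n, s) \<in> carrier (dihedral_group n)"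
    using x xis assms by (auto simp: dihedral_group_def)
  moreover have "(if s then i else (- i) mod int n, s) \<otimes>\<^bsub>dihedral_group n\<^esub> x =
      \<one>\<^bsub>dihedral_group n\<^esub>"
    using xis by (auto simp: dihedral_group_def mod_simps)
  ultimately show "\<exists>y\<in>carrier (dihedral_group n). y \<otimes>\<^bsub>dihedral_group n\<^esub> x =
      \<one>\<^bsub>dihedral_group n\<^esub>" by blast
qed (use assms in \<open>auto simp: dihedral_group_def\<close>)

lemma finite_dihedral_group: "finite (carrier (dihedral_group n))"
  by (simp add: dihedral_group_def)

lemma order_dihedral_group: "order (dihedral_group n) = 2 * n"
  by (simp add: dihedral_group_def order_def)

lemma dihedral_rot_pow:
  assumes "n > 0"
  shows "dihedral_rot n [^]\<^bsub>dihedral_group n\<^esub> (k::nat) = (int k mod int n, False)"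
proof -
  interpret group "dihedral_group n" by (rule group_dihedral_group[OF assms])
  show ?thesis
    by (induction k)
      (simp_all add: dihedral_group_def dihedral_rot_def mod_simps add.commute)
qed

lemma dihedral_relations:
  assumes "n > 0"
  shows "dihedral_rot n [^]\<^bsub>dihedral_group n\<^esub> n = \<one>\<^bsub>dihedral_group n\<^esub>"
    and "dihedral_refl [^]\<^bsub>dihedral_group n\<^esub> (2::nat) = \<one>\<^bsub>dihedral_group n\<^esub>"
    and "dihedral_refl \<otimes>\<^bsub>dihedral_group n\<^esub> dihedral_rot n =
      dihedral_rot n [^]\<^bsub>dihedral_group n\<^esub> (n - 1) \<otimes>\<^bsub>dihedral_group n\<^esub> dihedral_refl"
proof -
  interpret group "dihedral_group n" by (rule group_dihedral_group[OF assms])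
  show "dihedral_rot n [^]\<^bsub>dihedral_group n\<^esub> n = \<one>\<^bsub>dihedral_group n\<^esub>"
    unfolding dihedral_rot_pow[OF assms] by (simp add: dihedral_group_def)
  show "dihedral_refl [^]\<^bsub>dihedral_group n\<^esub> (2::nat) = \<one>\<^bsub>dihedral_group n\<^esub>"
    by (simp add: numeral_2_eq_2 dihedral_group_def dihedral_refl_def)
  have "(- 1) mod int n = (int n - 1) mod int n"
    by (metis diff_0 mod_diff_left_eq mod_self)
  then show "dihedral_refl \<otimes>\<^bsub>dihedral_group n\<^esub> dihedral_rot n =
      dihedral_rot n [^]\<^bsub>dihedral_group n\<^esub> (n - 1) \<otimes>\<^bsub>dihedral_group n\<^esub> dihedral_refl"
    unfolding dihedral_rot_pow[OF assms] using assms
    by (simp add: dihedral_group_def dihedral_refl_def dihedral_rot_def mod_simps of_nat_diff)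
qed

lemma dihedral_generated:
  assumes "n > 0"
  shows "generate (dihedral_group n) {dihedral_rot n, dihedral_refl} = carrier (dihedral_group n)"
proof
  interpret group "dihedral_group n" by (rule group_dihedral_group[OF assms])
  have sub: "{dihedral_rot n, dihedral_refl} \<subseteq> carrier (dihedral_group n)"
    using assms by (auto simp: dihedral_group_def dihedral_rot_def dihedral_refl_def)
  then show "generate (dihedral_group n) {dihedral_rot n, dihedral_refl} \<subseteq> carrier (dihedral_group n)"
    by (rule generate_incl)
  interpret H: subgroup "generate (dihedral_group n) {dihedral_rot n, dihedral_refl}" "dihedral_group n"
    by (rule generate_is_subgroup[OF sub])
  have rot: "dihedral_rot n [^]\<^bsub>dihedral_group n\<^esub> (k::nat)
      \<in> generate (dihedral_group n) {dihedral_rot n, dihedral_refl}" for k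
    by (induction k) (auto intro: generate.incl H.m_closed)
  show "carrier (dihedral_group n) \<subseteq> generate (dihedral_group n) {dihedral_rot n, dihedral_refl}"
  proof
    fix x assume x: "x \<in> carrier (dihedral_group n)"
    obtain i s where xis: "x = (i, s)" by fastforce
    from x xis have i: "0 \<le> i" "i < int n" by (auto simp: dihedral_group_def)
    have r: "dihedral_rot n [^]\<^bsub>dihedral_group n\<^esub> (nat i) = (i, False)"
      unfolding dihedral_rot_pow[OF assms] using i by simp
    have "x = (if s then (i, False) \<otimes>\<^bsub>dihedral_group n\<^esub> dihedral_refl else (i, False))"
      using i xis by (simp add: dihedral_group_def dihedral_refl_def)
    then show "x \<in> generate (dihedral_group n) {dihedral_rot n, dihedral_refl}"
      using rot[of "nat i"] unfolding r by (auto intro: generate.incl H.m_closed)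
  qed
qed


section \<open>The quantum double of a finite group\<close>

text \<open>An element of the algebra is its family of coordinates: \<open>a (g, h)\<close> is the coefficient
  of the basis vector \<open>g h\<^sup>*\<close>.\<close>

definition qd_basis :: "'a \<Rightarrow> 'a \<Rightarrow> 'a \<times> 'a \<Rightarrow> complex" where
  "qd_basis g h = (\<lambda>p. if p = (g, h) then 1 else 0)"

text \<open>The relations give
  \<open>(g h\<^sup>*)(k l\<^sup>*) = g k (k\<^bsup>-1\<^esup>hk)\<^sup>* l\<^sup>* = \<delta>(k\<^bsup>-1\<^esup>hk, l) (gk) l\<^sup>*\<close>.\<close>

definition qd_basis_mult ::
    "('a, 'm) monoid_scheme \<Rightarrow> 'a \<times> 'a \<Rightarrow> 'a \<times> 'a \<Rightarrow> 'a \<times> 'a \<Rightarrow> complex" where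
  "qd_basis_mult G = (\<lambda>(g, h) (k, l).
     if inv\<^bsub>G\<^esub> k \<otimes>\<^bsub>G\<^esub> h \<otimes>\<^bsub>G\<^esub> k = l then qd_basis (g \<otimes>\<^bsub>G\<^esub> k) l else (\<lambda>_. 0))"

definition quantum_double ::
    "('a, 'm) monoid_scheme \<Rightarrow> (complex, 'a \<times> 'a \<Rightarrow> complex) module" where
  "quantum_double G =
     \<lparr> carrier = {a. \<forall>p. p \<notin> carrier G \<times> carrier G \<longrightarrow> a p = 0},
       mult = (\<lambda>a b x. \<Sum>p\<in>carrier G \<times> carrier G. \<Sum>q\<in>carrier G \<times> carrier G.
                 a p * b q * qd_basis_mult G p q x),
       one = (\<lambda>x. \<Sum>h\<in>carrier G. qd_basis \<one>\<^bsub>G\<^esub> h x),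
       ring.zero = (\<lambda>x. 0),
       ring.add = (\<lambda>a b x. a x + b x),
       smult = (\<lambda>c a x. c * a x) \<rparr>"

text \<open>The copies of \<open>g\<close> and of \<open>h\<^sup>*\<close> inside the algebra.\<close>

definition qd_elem :: "('a, 'm) monoid_scheme \<Rightarrow> 'a \<Rightarrow> 'a \<times> 'a \<Rightarrow> complex" where
  "qd_elem G g = (\<lambda>x. \<Sum>h\<in>carrier G. qd_basis g h x)"

definition qd_dual :: "('a, 'm) monoid_scheme \<Rightarrow> 'a \<Rightarrow> 'a \<times> 'a \<Rightarrow> complex" where
  "qd_dual G h = qd_basis \<one>\<^bsub>G\<^esub> h"

lemma qd_ext:
  assumes "a \<in> carrier (quantum_double G)" "b \<in> carrier (quantum_double G)"
    and "\<And>x y. x \<in> carrier G \<Longrightarrow> y \<in> carrier G \<Longrightarrow> a (x, y) = b (x, y)"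
  shows "a = b"
proof
  fix p :: "'a \<times> 'a"
  obtain x y where p: "p = (x, y)" by fastforce
  show "a p = b p"
  proof (cases "x \<in> carrier G \<and> y \<in> carrier G")
    case True
    then show ?thesis using assms(3) p by simp
  next
    case False
    then show ?thesis using assms(1,2) p by (simp add: quantum_double_def)
  qed
qed

lemma qd_mult_apply:
  assumes "group G" "finite (carrier G)" "x \<in> carrier G" "y \<in> carrier G"
  shows "(a \<otimes>\<^bsub>quantum_double G\<^esub> b) (x, y) =
    (\<Sum>k\<in>carrier G. a (x \<otimes>\<^bsub>G\<^esub> inv\<^bsub>G\<^esub> k, k \<otimes>\<^bsub>G\<^esub> y \<otimes>\<^bsub>G\<^esub> inv\<^bsub>G\<^esub> k) * b (k, y))"
proof -
  interpret group G by fact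
  have *: "qd_basis_mult G (g, h) (k, l) (x, y) =
      (if l = y then if g = x \<otimes>\<^bsub>G\<^esub> inv\<^bsub>G\<^esub> k then
        if h = k \<otimes>\<^bsub>G\<^esub> y \<otimes>\<^bsub>G\<^esub> inv\<^bsub>G\<^esub> k then 1 else 0 else 0 else 0)"
    if "g \<in> carrier G" "h \<in> carrier G" "k \<in> carrier G" "l \<in> carrier G" for g h k l
  proof -
    have 1: "inv\<^bsub>G\<^esub> k \<otimes>\<^bsub>G\<^esub> h \<otimes>\<^bsub>G\<^esub> k = y \<longleftrightarrow> h = k \<otimes>\<^bsub>G\<^esub> y \<otimes>\<^bsub>G\<^esub> inv\<^bsub>G\<^esub> k"
      using that assms
      by (metis inv_closed inv_solve_left inv_solve_right' m_assoc m_closed)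
    have 2: "x = g \<otimes>\<^bsub>G\<^esub> k \<longleftrightarrow> g = x \<otimes>\<^bsub>G\<^esub> inv\<^bsub>G\<^esub> k"
      using that assms by (metis inv_solve_right)
    show ?thesis using 1 2 by (auto simp: qd_basis_mult_def qd_basis_def)
  qed
  have "(a \<otimes>\<^bsub>quantum_double G\<^esub> b) (x, y) =
      (\<Sum>g\<in>carrier G. \<Sum>h\<in>carrier G. \<Sum>k\<in>carrier G. \<Sum>l\<in>carrier G.
        a (g, h) * b (k, l) * qd_basis_mult G (g, h) (k, l) (x, y))"
    by (simp add: quantum_double_def sum.cartesian_product')
  also have "\<dots> = (\<Sum>g\<in>carrier G. \<Sum>h\<in>carrier G. \<Sum>k\<in>carrier G. \<Sum>l\<in>carrier G.
      if l = y then if g = x \<otimes>\<^bsub>G\<^esub> inv\<^bsub>G\<^esub> k then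
        if h = k \<otimes>\<^bsub>G\<^esub> y \<otimes>\<^bsub>G\<^esub> inv\<^bsub>G\<^esub> k then a (g, h) * b (k, l) else 0 else 0 else 0)"
    by (intro sum.cong refl) (simp add: *)
  also have "\<dots> = (\<Sum>g\<in>carrier G. \<Sum>h\<in>carrier G. \<Sum>k\<in>carrier G.
      if g = x \<otimes>\<^bsub>G\<^esub> inv\<^bsub>G\<^esub> k then
        if h = k \<otimes>\<^bsub>G\<^esub> y \<otimes>\<^bsub>G\<^esub> inv\<^bsub>G\<^esub> k then a (g, h) * b (k, y) else 0 else 0)"
    using assms by (simp add: sum.delta)
  also have "\<dots> = (\<Sum>k\<in>carrier G. \<Sum>g\<in>carrier G. \<Sum>h\<in>carrier G.
      if g = x \<otimes>\<^bsub>G\<^esub> inv\<^bsub>G\<^esub> k then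
        if h = k \<otimes>\<^bsub>G\<^esub> y \<otimes>\<^bsub>G\<^esub> inv\<^bsub>G\<^esub> k then a (g, h) * b (k, y) else 0 else 0)"
    by (subst (2) sum.swap, subst sum.swap) (rule refl)
  also have "\<dots> = (\<Sum>k\<in>carrier G. \<Sum>g\<in>carrier G. if g = x \<otimes>\<^bsub>G\<^esub> inv\<^bsub>G\<^esub> k then
      a (g, k \<otimes>\<^bsub>G\<^esub> y \<otimes>\<^bsub>G\<^esub> inv\<^bsub>G\<^esub> k) * b (k, y) else 0)"
    using assms by (intro sum.cong refl) (simp add: sum.delta)
  also have "\<dots> = (\<Sum>k\<in>carrier G. a (x \<otimes>\<^bsub>G\<^esub> inv\<^bsub>G\<^esub> k, k \<otimes>\<^bsub>G\<^esub> y \<otimes>\<^bsub>G\<^esub> inv\<^bsub>G\<^esub> k) * b (k, y))"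
    using assms by (intro sum.cong refl) (simp add: sum.delta)
  finally show ?thesis .
qed

lemma qd_mult_closed:
  assumes "group G"
  shows "a \<otimes>\<^bsub>quantum_double G\<^esub> b \<in> carrier (quantum_double G)"
proof -
  interpret group G by fact
  have "qd_basis_mult G p q x = 0"
    if "x \<notin> carrier G \<times> carrier G" "p \<in> carrier G \<times> carrier G" "q \<in> carrier G \<times> carrier G" for p q x
    using that by (auto simp: qd_basis_mult_def qd_basis_def)
  then show ?thesis by (auto simp: quantum_double_def intro!: sum.neutral)
qed

lemma qd_elem_apply:
  assumes "finite (carrier G)"
  shows "qd_elem G g (x, y) = (if x = g \<and> y \<in> carrier G then 1 else 0)"
proof (cases "x = g")
  case True
  then have "qd_elem G g (x, y) = (\<Sum>h\<in>carrier G. if h = y then 1 else 0)"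
    unfolding qd_elem_def by (intro sum.cong) (auto simp: qd_basis_def)
  then show ?thesis using True assms by simp
qed (simp add: qd_elem_def qd_basis_def)

lemma qd_one: "\<one>\<^bsub>quantum_double G\<^esub> = qd_elem G \<one>\<^bsub>G\<^esub>"
  by (simp add: quantum_double_def qd_elem_def)

lemma qd_basis_mult_eq:
  assumes "finite (carrier G)"
    and "g \<in> carrier G" "h \<in> carrier G" "k \<in> carrier G" "l \<in> carrier G"
  shows "qd_basis g h \<otimes>\<^bsub>quantum_double G\<^esub> qd_basis k l = qd_basis_mult G (g, h) (k, l)"
proof
  fix x
  have "(qd_basis g h \<otimes>\<^bsub>quantum_double G\<^esub> qd_basis k l) x =
    (\<Sum>p\<in>carrier G \<times> carrier G. \<Sum>q\<in>carrier G \<times> carrier G.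
      if q = (k, l) then if p = (g, h) then qd_basis_mult G p q x else 0 else 0)"
    by (simp add: quantum_double_def)
      (intro sum.cong refl, simp add: qd_basis_def)
  also have "\<dots> = qd_basis_mult G (g, h) (k, l) x"
    using assms by (simp add: sum.delta)
  finally show "(qd_basis g h \<otimes>\<^bsub>quantum_double G\<^esub> qd_basis k l) x =
    qd_basis_mult G (g, h) (k, l) x" .
qed

lemma ring_quantum_double:
  assumes "group G" "finite (carrier G)"
  shows "ring (quantum_double G)"
proof -
  interpret group G by fact
  let ?Q = "quantum_double G"
  note ext = qd_ext[where G = G]
  have one_closed: "\<one>\<^bsub>?Q\<^esub> \<in> carrier ?Q"
    unfolding qd_one using assms by (auto simp: quantum_double_def qd_elem_apply)
  have add_closed: "a \<oplus>\<^bsub>?Q\<^esub> b \<in> carrier ?Q" if "a \<in> carrier ?Q" "b \<in> carrier ?Q" for a b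
    using that by (auto simp: quantum_double_def)
  have add: "(a \<oplus>\<^bsub>?Q\<^esub> b) p = a p + b p" for a b p
    by (simp add: quantum_double_def)
  note app = qd_mult_apply[OF assms]
  note closed = qd_mult_closed[OF assms(1)]
  show ?thesis
  proof (rule ringI)
    show "abelian_group ?Q"
    proof (rule abelian_groupI)
      fix a assume "a \<in> carrier ?Q"
      then show "\<exists>b\<in>carrier ?Q. b \<oplus>\<^bsub>?Q\<^esub> a = \<zero>\<^bsub>?Q\<^esub>"
        by (intro bexI[of _ "\<lambda>x. - a x"]) (auto simp: quantum_double_def)
    qed (auto simp: quantum_double_def fun_eq_iff)
  next
    show "Group.monoid ?Q"
    proof (rule monoidI)
      fix a b c
      show "a \<otimes>\<^bsub>?Q\<^esub> b \<otimes>\<^bsub>?Q\<^esub> c = a \<otimes>\<^bsub>?Q\<^esub> (b \<otimes>\<^bsub>?Q\<^esub> c)"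
      proof (rule ext[OF closed closed])
        fix x y assume xy: "x \<in> carrier G" "y \<in> carrier G"
        have "(a \<otimes>\<^bsub>?Q\<^esub> b \<otimes>\<^bsub>?Q\<^esub> c) (x, y) = (\<Sum>k\<in>carrier G. \<Sum>m\<in>carrier G.
            a (x \<otimes>\<^bsub>G\<^esub> inv\<^bsub>G\<^esub> k \<otimes>\<^bsub>G\<^esub> inv\<^bsub>G\<^esub> m, m \<otimes>\<^bsub>G\<^esub> (k \<otimes>\<^bsub>G\<^esub> y \<otimes>\<^bsub>G\<^esub> inv\<^bsub>G\<^esub> k) \<otimes>\<^bsub>G\<^esub> inv\<^bsub>G\<^esub> m)
            * b (m, k \<otimes>\<^bsub>G\<^esub> y \<otimes>\<^bsub>G\<^esub> inv\<^bsub>G\<^esub> k) * c (k, y))"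
          using xy by (simp add: app sum_distrib_right)
        also have "\<dots> = (\<Sum>k\<in>carrier G. \<Sum>p\<in>carrier G.
            a (x \<otimes>\<^bsub>G\<^esub> inv\<^bsub>G\<^esub> p, p \<otimes>\<^bsub>G\<^esub> y \<otimes>\<^bsub>G\<^esub> inv\<^bsub>G\<^esub> p)
            * b (p \<otimes>\<^bsub>G\<^esub> inv\<^bsub>G\<^esub> k, k \<otimes>\<^bsub>G\<^esub> y \<otimes>\<^bsub>G\<^esub> inv\<^bsub>G\<^esub> k) * c (k, y))"
        proof (rule sum.cong[OF refl])
          fix k assume k: "k \<in> carrier G"
          show "(\<Sum>m\<in>carrier G.
            a (x \<otimes>\<^bsub>G\<^esub> inv\<^bsub>G\<^esub> k \<otimes>\<^bsub>G\<^esub> inv\<^bsub>G\<^esub> m, m \<otimes>\<^bsub>G\<^esub> (k \<otimes>\<^bsub>G\<^esub> y \<otimes>\<^bsub>G\<^esub> inv\<^bsub>G\<^esub> k) \<otimes>\<^bsub>G\<^esub> inv\<^bsub>G\<^esub> m)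
            * b (m, k \<otimes>\<^bsub>G\<^esub> y \<otimes>\<^bsub>G\<^esub> inv\<^bsub>G\<^esub> k) * c (k, y)) =
            (\<Sum>p\<in>carrier G. a (x \<otimes>\<^bsub>G\<^esub> inv\<^bsub>G\<^esub> p, p \<otimes>\<^bsub>G\<^esub> y \<otimes>\<^bsub>G\<^esub> inv\<^bsub>G\<^esub> p)
            * b (p \<otimes>\<^bsub>G\<^esub> inv\<^bsub>G\<^esub> k, k \<otimes>\<^bsub>G\<^esub> y \<otimes>\<^bsub>G\<^esub> inv\<^bsub>G\<^esub> k) * c (k, y))"
            by (rule sum.reindex_bij_witness
                  [where i = "\<lambda>p. p \<otimes>\<^bsub>G\<^esub> inv\<^bsub>G\<^esub> k" and j = "\<lambda>m. m \<otimes>\<^bsub>G\<^esub> k"])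
              (use k xy in \<open>auto simp: m_assoc inv_mult_group\<close>)
        qed
        also have "\<dots> = (a \<otimes>\<^bsub>?Q\<^esub> (b \<otimes>\<^bsub>?Q\<^esub> c)) (x, y)"
          using xy by (subst sum.swap) (simp add: app sum_distrib_left mult.assoc)
        finally show "(a \<otimes>\<^bsub>?Q\<^esub> b \<otimes>\<^bsub>?Q\<^esub> c) (x, y) = (a \<otimes>\<^bsub>?Q\<^esub> (b \<otimes>\<^bsub>?Q\<^esub> c)) (x, y)" .
      qed
    next
      fix a assume a: "a \<in> carrier ?Q"
      show "\<one>\<^bsub>?Q\<^esub> \<otimes>\<^bsub>?Q\<^esub> a = a"
      proof (rule ext[OF closed a])
        fix x y assume xy: "x \<in> carrier G" "y \<in> carrier G"
        have "(\<one>\<^bsub>?Q\<^esub> \<otimes>\<^bsub>?Q\<^esub> a) (x, y) = (\<Sum>k\<in>carrier G. if k = x then a (k, y) else 0)"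
          unfolding app[OF xy] qd_one
        proof (rule sum.cong[OF refl])
          fix k assume k: "k \<in> carrier G"
          then have "x \<otimes>\<^bsub>G\<^esub> inv\<^bsub>G\<^esub> k = \<one>\<^bsub>G\<^esub> \<longleftrightarrow> k = x"
            using xy by (metis inv_closed inv_inv inv_equality r_inv)
          then show "qd_elem G \<one>\<^bsub>G\<^esub> (x \<otimes>\<^bsub>G\<^esub> inv\<^bsub>G\<^esub> k, k \<otimes>\<^bsub>G\<^esub> y \<otimes>\<^bsub>G\<^esub> inv\<^bsub>G\<^esub> k) * a (k, y) =
            (if k = x then a (k, y) else 0)"
            using k xy assms by (simp add: qd_elem_apply)
        qed
        then show "(\<one>\<^bsub>?Q\<^esub> \<otimes>\<^bsub>?Q\<^esub> a) (x, y) = a (x, y)"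
          using xy assms by simp
      qed
      show "a \<otimes>\<^bsub>?Q\<^esub> \<one>\<^bsub>?Q\<^esub> = a"
      proof (rule ext[OF closed a])
        fix x y assume xy: "x \<in> carrier G" "y \<in> carrier G"
        have "(a \<otimes>\<^bsub>?Q\<^esub> \<one>\<^bsub>?Q\<^esub>) (x, y) = (\<Sum>k\<in>carrier G. if k = \<one>\<^bsub>G\<^esub> then a (x, y) else 0)"
          unfolding app[OF xy] qd_one
          by (rule sum.cong[OF refl]) (use xy assms in \<open>auto simp: qd_elem_apply\<close>)
        then show "(a \<otimes>\<^bsub>?Q\<^esub> \<one>\<^bsub>?Q\<^esub>) (x, y) = a (x, y)"
          using assms by simp
      qed
    qed (use closed one_closed in auto)
  next
    fix a b c assume abc: "a \<in> carrier ?Q" "b \<in> carrier ?Q" "c \<in> carrier ?Q"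
    show "(a \<oplus>\<^bsub>?Q\<^esub> b) \<otimes>\<^bsub>?Q\<^esub> c = a \<otimes>\<^bsub>?Q\<^esub> c \<oplus>\<^bsub>?Q\<^esub> b \<otimes>\<^bsub>?Q\<^esub> c"
      by (rule ext[OF closed add_closed[OF closed closed]])
        (simp add: app add sum.distrib algebra_simps)
    show "c \<otimes>\<^bsub>?Q\<^esub> (a \<oplus>\<^bsub>?Q\<^esub> b) = c \<otimes>\<^bsub>?Q\<^esub> a \<oplus>\<^bsub>?Q\<^esub> c \<otimes>\<^bsub>?Q\<^esub> b"
      by (rule ext[OF closed add_closed[OF closed closed]])
        (simp add: app add sum.distrib algebra_simps)
  qed
qed

text \<open>The defining relations of the quantum double.\<close>

lemma qd_relations:
  assumes "group G" "finite (carrier G)" "g \<in> carrier G" "h \<in> carrier G"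
  shows "qd_elem G g \<otimes>\<^bsub>quantum_double G\<^esub> qd_elem G h = qd_elem G (g \<otimes>\<^bsub>G\<^esub> h)"
    and "qd_dual G g \<otimes>\<^bsub>quantum_double G\<^esub> qd_dual G h = (if g = h then qd_dual G h else (\<lambda>_. 0))"
    and "qd_elem G g \<otimes>\<^bsub>quantum_double G\<^esub> qd_dual G h = qd_basis g h"
    and "qd_dual G h \<otimes>\<^bsub>quantum_double G\<^esub> qd_elem G g =
      qd_elem G g \<otimes>\<^bsub>quantum_double G\<^esub> qd_dual G (inv\<^bsub>G\<^esub> g \<otimes>\<^bsub>G\<^esub> h \<otimes>\<^bsub>G\<^esub> g)"
proof -
  interpret group G by fact
  let ?Q = "quantum_double G"
  note ext = qd_ext[where G = G]
  note app = qd_mult_apply[OF assms(1,2)]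
  note closed = qd_mult_closed[OF assms(1)]
  have elem: "qd_elem G g \<in> carrier ?Q" if "g \<in> carrier G" for g
    using that assms by (auto simp: quantum_double_def qd_elem_apply)
  have basis: "qd_basis g h \<in> carrier ?Q" if "g \<in> carrier G" "h \<in> carrier G" for g h
    using that by (auto simp: quantum_double_def qd_basis_def)
  have 0: "x = u \<otimes>\<^bsub>G\<^esub> v \<longleftrightarrow> x \<otimes>\<^bsub>G\<^esub> inv\<^bsub>G\<^esub> v = u"
    if "x \<in> carrier G" "u \<in> carrier G" "v \<in> carrier G" for x u v
    using that by (metis inv_solve_right)
  show "qd_elem G g \<otimes>\<^bsub>?Q\<^esub> qd_elem G h = qd_elem G (g \<otimes>\<^bsub>G\<^esub> h)"
  proof (rule ext[OF closed elem])
    fix x y assume xy: "x \<in> carrier G" "y \<in> carrier G"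
    have "(qd_elem G g \<otimes>\<^bsub>?Q\<^esub> qd_elem G h) (x, y) =
        (\<Sum>k\<in>carrier G. if k = h then if x = g \<otimes>\<^bsub>G\<^esub> h then 1 else 0 else 0)"
      unfolding app[OF xy]
      by (rule sum.cong[OF refl]) (use xy assms in \<open>auto simp: qd_elem_apply 0\<close>)
    then show "(qd_elem G g \<otimes>\<^bsub>?Q\<^esub> qd_elem G h) (x, y) = qd_elem G (g \<otimes>\<^bsub>G\<^esub> h) (x, y)"
      using xy assms by (simp add: qd_elem_apply)
  qed (use assms in auto)
  show "qd_dual G g \<otimes>\<^bsub>?Q\<^esub> qd_dual G h = (if g = h then qd_dual G h else (\<lambda>_. 0))"
    using assms by (simp add: qd_dual_def qd_basis_mult_eq qd_basis_mult_def)
  have gd: "qd_elem G g \<otimes>\<^bsub>?Q\<^esub> qd_dual G h = qd_basis g h" if h: "h \<in> carrier G" for h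
  proof (rule ext[OF closed basis])
    fix x y assume xy: "x \<in> carrier G" "y \<in> carrier G"
    have "(qd_elem G g \<otimes>\<^bsub>?Q\<^esub> qd_dual G h) (x, y) =
        (\<Sum>k\<in>carrier G. if k = \<one>\<^bsub>G\<^esub> then if x = g \<and> y = h then 1 else 0 else 0)"
      unfolding app[OF xy]
      by (rule sum.cong[OF refl])
        (use xy assms h in \<open>auto simp: qd_elem_apply qd_dual_def qd_basis_def\<close>)
    then show "(qd_elem G g \<otimes>\<^bsub>?Q\<^esub> qd_dual G h) (x, y) = qd_basis g h (x, y)"
      using xy assms h by (simp add: qd_basis_def)
  qed (use assms h in auto)
  then show "qd_elem G g \<otimes>\<^bsub>?Q\<^esub> qd_dual G h = qd_basis g h"
    using assms by simp
  have "qd_dual G h \<otimes>\<^bsub>?Q\<^esub> qd_elem G g = qd_basis g (inv\<^bsub>G\<^esub> g \<otimes>\<^bsub>G\<^esub> h \<otimes>\<^bsub>G\<^esub> g)"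
  proof (rule ext[OF closed basis])
    fix x y assume xy: "x \<in> carrier G" "y \<in> carrier G"
    have 1: "g \<otimes>\<^bsub>G\<^esub> y \<otimes>\<^bsub>G\<^esub> inv\<^bsub>G\<^esub> g = h \<longleftrightarrow> y = inv\<^bsub>G\<^esub> g \<otimes>\<^bsub>G\<^esub> h \<otimes>\<^bsub>G\<^esub> g"
      using xy assms by (metis inv_closed inv_solve_left inv_solve_right' m_assoc m_closed)
    have 2: "x \<otimes>\<^bsub>G\<^esub> inv\<^bsub>G\<^esub> g = \<one>\<^bsub>G\<^esub> \<longleftrightarrow> x = g"
      using xy assms by (metis 0 l_one one_closed)
    have "(qd_dual G h \<otimes>\<^bsub>?Q\<^esub> qd_elem G g) (x, y) =
        (\<Sum>k\<in>carrier G. if k = g then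
          if x = g \<and> y = inv\<^bsub>G\<^esub> g \<otimes>\<^bsub>G\<^esub> h \<otimes>\<^bsub>G\<^esub> g then 1 else 0 else 0)"
      unfolding app[OF xy]
      by (rule sum.cong[OF refl])
        (use xy assms in \<open>auto simp: qd_elem_apply qd_dual_def qd_basis_def 1 2\<close>)
    then show "(qd_dual G h \<otimes>\<^bsub>?Q\<^esub> qd_elem G g) (x, y) =
        qd_basis g (inv\<^bsub>G\<^esub> g \<otimes>\<^bsub>G\<^esub> h \<otimes>\<^bsub>G\<^esub> g) (x, y)"
      using xy assms by (simp add: qd_basis_def)
  qed (use assms in auto)
  then show "qd_dual G h \<otimes>\<^bsub>?Q\<^esub> qd_elem G g =
      qd_elem G g \<otimes>\<^bsub>?Q\<^esub> qd_dual G (inv\<^bsub>G\<^esub> g \<otimes>\<^bsub>G\<^esub> h \<otimes>\<^bsub>G\<^esub> g)"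
    using gd assms by simp
qed


section \<open>Irreducible representations of complex algebras\<close>

text \<open>Representations on the complex vector space \<open>complex ^ 'd\<close>, whose dimension is \<open>CARD('d)\<close>.
  Values of \<open>\<rho>\<close> outside the carrier are irrelevant.\<close>

definition algebra_representation ::
    "(complex, 'b, 'm) module_scheme \<Rightarrow> ('b \<Rightarrow> complex ^ 'd \<Rightarrow> complex ^ 'd) \<Rightarrow> bool" where
  "algebra_representation A \<rho> \<longleftrightarrow>
     (\<forall>a\<in>carrier A. Vector_Spaces.linear (*s) (*s) (\<rho> a)) \<and>
     (\<forall>a\<in>carrier A. \<forall>b\<in>carrier A. \<forall>v. \<rho> (a \<oplus>\<^bsub>A\<^esub> b) v = \<rho> a v + \<rho> b v) \<and>
     (\<forall>c. \<forall>a\<in>carrier A. \<forall>v. \<rho> (c \<odot>\<^bsub>A\<^esub> a) v = c *s \<rho> a v) \<and>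
     (\<forall>a\<in>carrier A. \<forall>b\<in>carrier A. \<rho> (a \<otimes>\<^bsub>A\<^esub> b) = \<rho> a \<circ> \<rho> b) \<and>
     \<rho> \<one>\<^bsub>A\<^esub> = id"

text \<open>The representation space is automatically nonzero, since \<open>CARD('d) > 0\<close>.\<close>

definition irreducible_representation ::
    "(complex, 'b, 'm) module_scheme \<Rightarrow> ('b \<Rightarrow> complex ^ 'd \<Rightarrow> complex ^ 'd) \<Rightarrow> bool" where
  "irreducible_representation A \<rho> \<longleftrightarrow>
     algebra_representation A \<rho> \<and>
     (\<forall>W. vec.subspace W \<longrightarrow> (\<forall>a\<in>carrier A. \<rho> a ` W \<subseteq> W) \<longrightarrow> W = {0} \<or> W = UNIV)"

end

theory Submission
  imports Defs
begin

text \<open>An irreducible representation of \<open>D(G)\<close> decomposes into the images of the orthogonal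
  idempotents \<open>h\<^sup>*\<close>, and \<open>g\<close> carries the image of \<open>h\<^sup>*\<close> onto the image of \<open>(g h g\<^bsup>-1\<^esup>)\<^sup>*\<close>.
  Choose \<open>h\<close> with nonzero image. If \<open>A\<close> is a commutative set of elements centralizing \<open>h\<close>, its
  members act on that image by commuting operators of finite order, so they have a joint
  eigenvector \<open>v\<close>. The translates \<open>g v\<close> span an invariant subspace, hence the whole space, and up
  to scalars there is only one of them for each coset \<open>g A\<close> (\<open>dimension_le\<close>). The dimension is
  therefore at most the number of cosets, and if \<open>A\<close> is the full centralizer it equals the size
  of the conjugacy class of \<open>h\<close>, since translates belonging to different conjugates are linearly
  independent (\<open>dimension_eq_card_conj_class\<close>).

  In \<open>D\<^sub>n\<close> a rotation is centralized by all rotations, which form a commutative subgroup with two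
  cosets, so a rotation \<open>h\<close> only allows dimension at most two. A reflection has a commutative
  centralizer, and its class has \<open>n\<close> elements for odd \<open>n\<close> and \<open>n / 2\<close> elements for even \<open>n\<close>; this
  number is three exactly for \<open>n = 3\<close> and \<open>n = 6\<close>. Conversely, each conjugacy class of a finite
  group is the basis of an irreducible representation of \<open>D(G)\<close>
  (\<open>conj_class_representation\<close>), and the class of a reflection gives one of dimension three in
  these two cases.\<close>

section \<open>Eigenvectors of commuting operators of finite order\<close>

text \<open>The Fourier components \<open>w j\<close> of the orbit of \<open>u\<close> under \<open>f\<close> are eigenvectors or zero, and
  they add up to \<open>n u\<close>, so one of them is nonzero. As combinations of the orbit they stay in
  each \<open>f\<close>-stable subspace that contains \<open>u\<close>.\<close>

lemma eigenvector_of_finite_order: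
  fixes f :: "complex ^ 'd \<Rightarrow> complex ^ 'd"
  assumes lin: "Vector_Spaces.linear (*s) (*s) f" and U: "vec.subspace U" "f ` U \<subseteq> U"
    and u: "u \<in> U" "u \<noteq> 0" and n: "n > 0" "(f ^^ n) u = u"
  obtains v c where "v \<in> U" "v \<noteq> 0" "f v = c *s v"
proof -
  interpret f: Vector_Spaces.linear "(*s)" "(*s)" f by (fact lin)
  define \<omega> where "\<omega> = exp (2 * of_real pi * \<i> / of_nat n)"
  have \<omega>_pow: "\<omega> ^ j = 1 \<longleftrightarrow> n dvd j" for j
    using complex_root_unity_eq_1[of n j] n
    by (simp add: \<omega>_def flip: exp_of_nat_mult) (simp add: mult_ac)
  define w where "w j = (\<Sum>k<n. (\<omega> ^ j) ^ k *s (f ^^ k) u)" for j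
  have pow_in: "(f ^^ k) u \<in> U" for k
    by (induction k) (use u U in auto)
  have w_in: "w j \<in> U" for j
    unfolding w_def by (intro vec.subspace_sum vec.subspace_scale U pow_in)
  have w_eigen: "f (w j) = inverse (\<omega> ^ j) *s w j" for j
  proof -
    let ?t = "\<lambda>k. (\<omega> ^ j) ^ k *s (f ^^ k) u"
    have "\<omega> ^ j *s f (w j) = (\<Sum>k<n. ?t (Suc k))"
      by (simp add: w_def f.sum f.scale vec.scale_sum_right)
    also have "\<dots> = w j + ?t n - ?t 0"
      unfolding w_def using sum.lessThan_Suc_shift[of ?t n] by simp
    also have "\<dots> = w j"
      using n \<omega>_pow[of "j * n"] by (simp add: power_mult)
    finally have "inverse (\<omega> ^ j) *s w j = inverse (\<omega> ^ j) *s (\<omega> ^ j *s f (w j))"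
      by simp
    also have "\<dots> = f (w j)"
      by (simp add: \<omega>_def)
    finally show ?thesis by simp
  qed
  have "(\<Sum>j<n. w j) = (\<Sum>k<n. (\<Sum>j<n. (\<omega> ^ j) ^ k) *s (f ^^ k) u)"
    unfolding w_def by (subst sum.swap) (simp add: vec.scale_sum_left)
  also have "\<dots> = (\<Sum>k<n. if k = 0 then of_nat n *s u else 0)"
  proof (rule sum.cong[OF refl])
    fix k assume k: "k \<in> {..<n}"
    have "(\<Sum>j<n. (\<omega> ^ j) ^ k) = (\<Sum>j<n. (\<omega> ^ k) ^ j)"
      by (simp add: mult.commute flip: power_mult)
    also have "\<dots> = 0" if "k > 0"
    proof -
      have "\<omega> ^ k \<noteq> 1" "(\<omega> ^ k) ^ n = 1"
        using that k \<omega>_pow[of k] \<omega>_pow[of "k * n"] by (auto dest: dvd_imp_le simp: power_mult)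
      then show ?thesis using geometric_sum[of "\<omega> ^ k" n] by simp
    qed
    finally show "(\<Sum>j<n. (\<omega> ^ j) ^ k) *s (f ^^ k) u = (if k = 0 then of_nat n *s u else 0)"
      by (cases "k = 0") auto
  qed
  also have "\<dots> = of_nat n *s u" using n by simp
  finally have "(\<Sum>j<n. w j) \<noteq> 0" using n u by simp
  then obtain j where "w j \<noteq> 0" by (meson sum.neutral)
  with w_in w_eigen show thesis by (intro that)
qed

lemma joint_eigenvector:
  fixes F :: "(complex ^ 'd \<Rightarrow> complex ^ 'd) set"
  assumes "finite F" and "vec.subspace U" "u \<in> U" "u \<noteq> 0"
    and "\<And>f. f \<in> F \<Longrightarrow> Vector_Spaces.linear (*s) (*s) f" "\<And>f. f \<in> F \<Longrightarrow> f ` U \<subseteq> U"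
    and "\<And>f. f \<in> F \<Longrightarrow> \<exists>n>0. f ^^ n = id"
    and "\<And>f g v. f \<in> F \<Longrightarrow> g \<in> F \<Longrightarrow> f (g v) = g (f v)"
  shows "\<exists>v\<in>U. v \<noteq> 0 \<and> (\<forall>f\<in>F. \<exists>c. f v = c *s v)"
  using assms
proof (induction F arbitrary: U u rule: finite_induct)
  case empty
  then show ?case by auto
next
  case (insert f F)
  obtain n where n: "n > 0" "f ^^ n = id" using insert.prems(6) by blast
  obtain v c where v: "v \<in> U" "v \<noteq> 0" "f v = c *s v"
    using eigenvector_of_finite_order[of f U u n] insert.prems n by (metis id_apply insertI1)
  interpret f: Vector_Spaces.linear "(*s)" "(*s)" f using insert.prems(4) by simp
  \<comment> \<open>The other operators commute with \<open>f\<close>, so they preserve its eigenspace.\<close>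
  let ?W = "{w \<in> U. f w = c *s w}"
  have "\<exists>v\<in>?W. v \<noteq> 0 \<and> (\<forall>g\<in>F. \<exists>d. g v = d *s v)"
  proof (rule insert.IH)
    show "vec.subspace ?W"
      using insert.prems(1)
      by (auto simp: vec.subspace_def f.add f.scale f.zero vec.scale_right_distrib mult.commute)
    show "g ` ?W \<subseteq> ?W" if g: "g \<in> F" for g
    proof -
      interpret g: Vector_Spaces.linear "(*s)" "(*s)" g using insert.prems(4) g by simp
      show ?thesis
        using insert.prems(5)[of g] insert.prems(7)[of f g] g by (auto simp: g.scale)
    qed
  qed (use v insert.prems in auto)
  then show ?case by auto
qed

section \<open>Irreducible representations of a quantum double\<close>

definition conj_class :: "('a, 'm) monoid_scheme \<Rightarrow> 'a \<Rightarrow> 'a set" where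
  "conj_class G h = (\<lambda>g. g \<otimes>\<^bsub>G\<^esub> h \<otimes>\<^bsub>G\<^esub> inv\<^bsub>G\<^esub> g) ` carrier G"

definition centralizer :: "('a, 'm) monoid_scheme \<Rightarrow> 'a \<Rightarrow> 'a set" where
  "centralizer G h = {g \<in> carrier G. g \<otimes>\<^bsub>G\<^esub> h = h \<otimes>\<^bsub>G\<^esub> g}"

lemma (in group) inv_cancel:
  assumes "g \<in> carrier G" "x \<in> carrier G"
  shows "inv g \<otimes> (g \<otimes> x) = x" "g \<otimes> (inv g \<otimes> x) = x"
  using assms by (simp_all flip: m_assoc)

locale irreducible_double = group G for G :: "('a, 'm) monoid_scheme" (structure) +
  fixes \<rho> :: "('a \<times> 'a \<Rightarrow> complex) \<Rightarrow> complex ^ 'd \<Rightarrow> complex ^ 'd"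
  assumes fin: "finite (carrier G)"
    and irreducible: "irreducible_representation (quantum_double G) \<rho>"
begin

definition E :: "'a \<Rightarrow> complex ^ 'd \<Rightarrow> complex ^ 'd" where
  "E g = \<rho> (qd_elem G g)"

text \<open>A vector fixed by \<open>P h\<close> is called a vector of weight \<open>h\<close> below.\<close>

definition P :: "'a \<Rightarrow> complex ^ 'd \<Rightarrow> complex ^ 'd" where
  "P h = \<rho> (qd_dual G h)"

lemma representation: "algebra_representation (quantum_double G) \<rho>"
  using irreducible by (simp add: irreducible_representation_def)

lemma qd_elem_closed: "g \<in> carrier G \<Longrightarrow> qd_elem G g \<in> carrier (quantum_double G)"
  using fin by (auto simp: quantum_double_def qd_elem_apply)

lemma qd_dual_closed: "h \<in> carrier G \<Longrightarrow> qd_dual G h \<in> carrier (quantum_double G)"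
  by (auto simp: quantum_double_def qd_dual_def qd_basis_def)

lemma linear_E: "g \<in> carrier G \<Longrightarrow> Vector_Spaces.linear (*s) (*s) (E g)"
  using representation qd_elem_closed by (simp add: algebra_representation_def E_def)

lemma linear_P: "h \<in> carrier G \<Longrightarrow> Vector_Spaces.linear (*s) (*s) (P h)"
  using representation qd_dual_closed by (simp add: algebra_representation_def P_def)

lemma rho_mult:
  "a \<in> carrier (quantum_double G) \<Longrightarrow> b \<in> carrier (quantum_double G) \<Longrightarrow>
    \<rho> a (\<rho> b v) = \<rho> (a \<otimes>\<^bsub>quantum_double G\<^esub> b) v"
  using representation by (simp add: algebra_representation_def)

lemma rho_zero: "\<rho> (\<lambda>_. 0) v = 0"
proof -
  have "(\<lambda>_. 0) \<in> carrier (quantum_double G)" by (simp add: quantum_double_def)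
  then have "\<rho> (0 \<odot>\<^bsub>quantum_double G\<^esub> (\<lambda>_. 0)) v = 0 *s \<rho> (\<lambda>_. 0) v"
    using representation unfolding algebra_representation_def by blast
  then show ?thesis by (simp add: quantum_double_def)
qed

lemma E_mult: "g \<in> carrier G \<Longrightarrow> h \<in> carrier G \<Longrightarrow> E g (E h v) = E (g \<otimes> h) v"
  using qd_relations(1)[OF is_group fin] by (simp add: E_def rho_mult qd_elem_closed)

lemma E_one: "E \<one> v = v"
  using representation by (simp add: E_def algebra_representation_def flip: qd_one)

lemma P_P: "g \<in> carrier G \<Longrightarrow> h \<in> carrier G \<Longrightarrow> P g (P h v) = (if g = h then P h v else 0)"
  using qd_relations(2)[OF is_group fin, of g h]
  by (simp add: P_def rho_mult qd_dual_closed rho_zero)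

lemma P_E:
  "g \<in> carrier G \<Longrightarrow> h \<in> carrier G \<Longrightarrow> P h (E g v) = E g (P (inv g \<otimes> h \<otimes> g) v)"
  using qd_relations(4)[OF is_group fin, of g h]
  by (simp add: P_def E_def rho_mult qd_dual_closed qd_elem_closed)

lemma E_zero: "g \<in> carrier G \<Longrightarrow> E g 0 = 0"
proof -
  assume "g \<in> carrier G"
  then interpret g: Vector_Spaces.linear "(*s)" "(*s)" "E g" by (rule linear_E)
  show ?thesis by (rule g.zero)
qed

lemma E_inj:
  assumes "g \<in> carrier G" "E g v = 0"
  shows "v = 0"
proof -
  have "v = E (inv g) (E g v)" using assms(1) by (simp add: E_mult E_one)
  then show ?thesis using assms by (simp add: E_zero)
qed

lemma E_pow: "g \<in> carrier G \<Longrightarrow> (E g ^^ k) v = E (g [^] k) v"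
  by (induction k) (simp_all add: E_one E_mult nat_pow_Suc2 flip: nat_pow_Suc2)

text \<open>It suffices to look at the operators \<open>E g \<circ> P h\<close>, because the elements \<open>gh\<^sup>*\<close> span the
  algebra.\<close>

lemma rho_in_subspace:
  assumes W: "vec.subspace W" and a: "a \<in> carrier (quantum_double G)"
    and EP: "\<And>g h. g \<in> carrier G \<Longrightarrow> h \<in> carrier G \<Longrightarrow> E g (P h v) \<in> W"
  shows "\<rho> a v \<in> W"
proof -
  have "\<rho> (\<lambda>p. if p \<in> S then a p else 0) v \<in> W"
    if "finite S" "S \<subseteq> carrier G \<times> carrier G" for S
    using that
  proof (induction S)
    case empty
    show ?case using W by (simp add: rho_zero vec.subspace_0)
  next
    case (insert p S)
    obtain g h where p: "p = (g, h)" by fastforce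
    have gh: "g \<in> carrier G" "h \<in> carrier G" using insert.prems p by auto
    let ?Q = "quantum_double G"
    let ?b = "\<lambda>p. if p \<in> S then a p else 0"
    have b: "?b \<in> carrier ?Q" and e: "qd_basis g h \<in> carrier ?Q"
      and ae: "a p \<odot>\<^bsub>?Q\<^esub> qd_basis g h \<in> carrier ?Q"
      using insert.prems gh by (auto simp: quantum_double_def qd_basis_def)
    have "(\<lambda>q. if q \<in> insert p S then a q else 0) = a p \<odot>\<^bsub>?Q\<^esub> qd_basis g h \<oplus>\<^bsub>?Q\<^esub> ?b"
      using insert.hyps p by (auto simp: quantum_double_def qd_basis_def fun_eq_iff)
    moreover have "\<rho> (a p \<odot>\<^bsub>?Q\<^esub> qd_basis g h \<oplus>\<^bsub>?Q\<^esub> ?b) v = a p *s \<rho> (qd_basis g h) v + \<rho> ?b v"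
      using representation b e ae by (simp add: algebra_representation_def)
    moreover have "\<rho> (qd_basis g h) v = E g (P h v)"
      using qd_relations(3)[OF is_group fin gh]
      by (simp add: E_def P_def rho_mult gh qd_elem_closed qd_dual_closed)
    ultimately show ?case
      using insert gh W EP by (auto intro!: vec.subspace_add vec.subspace_scale)
  qed
  moreover have "(\<lambda>p. if p \<in> carrier G \<times> carrier G then a p else 0) = a"
    using a by (auto simp: quantum_double_def fun_eq_iff)
  ultimately show ?thesis using fin by (metis finite_SigmaI subset_refl)
qed

lemma invariant_subspace:
  assumes "vec.subspace W" "v \<in> W" "v \<noteq> 0"
    and "\<And>g v. g \<in> carrier G \<Longrightarrow> v \<in> W \<Longrightarrow> E g v \<in> W"
    and "\<And>h v. h \<in> carrier G \<Longrightarrow> v \<in> W \<Longrightarrow> P h v \<in> W"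
  shows "W = UNIV"
proof -
  have "\<forall>a\<in>carrier (quantum_double G). \<rho> a ` W \<subseteq> W"
    using rho_in_subspace[OF assms(1)] assms(4,5) by blast
  then show ?thesis
    using irreducible assms(1-3) by (auto simp: irreducible_representation_def)
qed

text \<open>If all \<open>P h\<close> killed some nonzero vector, then every element of the algebra would, including
  the unit.\<close>

lemma weight_exists:
  obtains h v where "h \<in> carrier G" "v \<noteq> 0" "P h v = v"
proof -
  obtain w :: "complex ^ 'd" where w: "w \<noteq> 0"
    by (meson axis_eq_0_iff one_neq_zero)
  have "\<exists>h\<in>carrier G. P h w \<noteq> 0"
  proof (rule ccontr)
    assume "\<not> ?thesis"
    then have "E g (P h w) \<in> {0}" if "g \<in> carrier G" "h \<in> carrier G" for g h
      using that by (simp add: E_zero)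
    then have "E \<one> w \<in> {0}"
      using rho_in_subspace[of "{0}" "qd_elem G \<one>" w] qd_elem_closed
      unfolding E_def[of \<one>] by (meson one_closed vec.subspace_single_0)
    then show False using w by (simp add: E_one)
  qed
  then show thesis using that P_P by metis
qed

text \<open>Elements that commute with \<open>h\<close> preserve the space of vectors of weight \<open>h\<close>, and their
  operators have finite order because the group is finite.\<close>

lemma E_eigenvector:
  assumes A: "A \<subseteq> centralizer G h" "\<And>a b. a \<in> A \<Longrightarrow> b \<in> A \<Longrightarrow> a \<otimes> b = b \<otimes> a"
    and h: "h \<in> carrier G" and u: "u \<noteq> 0" "P h u = u"
  obtains v c where "v \<noteq> 0" "P h v = v" "\<And>a. a \<in> A \<Longrightarrow> E a v = c a *s v"
proof -
  interpret p: Vector_Spaces.linear "(*s)" "(*s)" "P h" using h by (rule linear_P)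
  have Ac: "A \<subseteq> carrier G" using A(1) by (auto simp: centralizer_def)
  let ?U = "{v. P h v = v}"
  have "\<exists>v\<in>?U. v \<noteq> 0 \<and> (\<forall>f\<in>E ` A. \<exists>c. f v = c *s v)"
  proof (rule joint_eigenvector)
    show "finite (E ` A)" using Ac fin finite_subset by blast
    show "vec.subspace ?U" by (auto simp: vec.subspace_def p.add p.scale p.zero)
    show "u \<in> ?U" "u \<noteq> 0" using u by auto
    fix f assume "f \<in> E ` A"
    then obtain a where a: "a \<in> A" "a \<in> carrier G" "f = E a" using Ac by auto
    show "Vector_Spaces.linear (*s) (*s) f" using a by (simp add: linear_E)
    have "a \<otimes> h = h \<otimes> a" using a(1) A(1) by (auto simp: centralizer_def)
    then have "inv a \<otimes> h \<otimes> a = inv a \<otimes> (a \<otimes> h)" using a(2) h by (simp add: m_assoc)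
    then have "inv a \<otimes> h \<otimes> a = h" using a(2) h by (simp add: inv_cancel)
    then show "f ` ?U \<subseteq> ?U" using a h by (auto simp: P_E)
    show "\<exists>n>0. f ^^ n = id"
    proof (intro exI conjI)
      show "order G > 0" using fin order_gt_0_iff_finite by blast
      show "f ^^ order G = id"
        unfolding a(3) using a(2) by (intro ext) (simp add: E_pow E_one pow_order_eq_1)
    qed
    fix g v assume "g \<in> E ` A"
    then show "f (g v) = g (f v)" using a A(2) Ac by (auto simp: E_mult)
  qed
  then obtain v where "v \<in> ?U" "v \<noteq> 0" "\<forall>a\<in>A. \<exists>c. E a v = c *s v" by auto
  then show thesis using that by (metis (mono_tags, lifting) mem_Collect_eq)
qed

text \<open>Up to a scalar, the translate of \<open>v\<close> by \<open>t a\<close> is its translate by \<open>t\<close>, so the given vectors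
  already span all translates. That span is invariant: \<open>E g\<close> permutes the translates, and each
  translate has a weight, so \<open>P k\<close> fixes or kills it.\<close>

lemma translates_span:
  assumes h: "h \<in> carrier G" and A: "A \<subseteq> carrier G" and v: "v \<noteq> 0" "P h v = v"
    and c: "\<And>a. a \<in> A \<Longrightarrow> E a v = c a *s v"
    and T: "T \<subseteq> carrier G" "\<And>x. x \<in> carrier G \<Longrightarrow> \<exists>t\<in>T. \<exists>a\<in>A. x = t \<otimes> a"
  shows "vec.span ((\<lambda>t. E t v) ` T) = UNIV"
proof -
  let ?W = "vec.span ((\<lambda>t. E t v) ` T)"
  have in_W: "E x v \<in> ?W" if x: "x \<in> carrier G" for x
  proof -
    obtain t a where ta: "t \<in> T" "a \<in> A" "x = t \<otimes> a" using T(2) x by blast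
    then have carr: "t \<in> carrier G" "a \<in> carrier G" using T(1) A by auto
    then interpret t: Vector_Spaces.linear "(*s)" "(*s)" "E t" by (intro linear_E)
    have "E x v = E t (E a v)" using ta carr by (simp add: E_mult)
    then have "E x v = c a *s E t v" using ta c by (simp add: t.scale)
    then show ?thesis using ta by (simp add: vec.span_base vec.span_scale)
  qed
  have stable: "f w \<in> ?W"
    if f: "Vector_Spaces.linear (*s) (*s) f" "\<And>t. t \<in> T \<Longrightarrow> f (E t v) \<in> ?W" and w: "w \<in> ?W" for f w
  proof -
    interpret f: Vector_Spaces.linear "(*s)" "(*s)" f by (fact f(1))
    show ?thesis using w
      by (induction rule: vec.span_induct_alt)
        (auto simp: f.add f.scale f.zero vec.span_zero vec.span_add vec.span_scale f(2))
  qed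
  show ?thesis
  proof (rule invariant_subspace)
    show "v \<in> ?W" using in_W[of \<one>] by (simp add: E_one)
    show "E g w \<in> ?W" if g: "g \<in> carrier G" and w: "w \<in> ?W" for g w
    proof (rule stable[OF linear_E[OF g] _ w])
      fix t assume "t \<in> T"
      then have "t \<in> carrier G" using T by auto
      then show "E g (E t v) \<in> ?W" using g by (simp add: E_mult in_W)
    qed
    show "P k w \<in> ?W" if k: "k \<in> carrier G" and w: "w \<in> ?W" for k w
    proof (rule stable[OF linear_P[OF k] _ w])
      fix t assume t: "t \<in> T"
      then have tc: "t \<in> carrier G" using T by auto
      interpret t: Vector_Spaces.linear "(*s)" "(*s)" "E t" using tc by (rule linear_E)
      have "P (inv t \<otimes> k \<otimes> t) v = (if inv t \<otimes> k \<otimes> t = h then v else 0)"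
        using P_P[of "inv t \<otimes> k \<otimes> t" h v] tc k h v by simp
      then show "P k (E t v) \<in> ?W"
        using tc k in_W by (simp add: P_E t.zero vec.span_zero)
    qed
  qed (use v in auto)
qed

lemma dimension_le:
  assumes h: "h \<in> carrier G" and u: "u \<noteq> 0" "P h u = u"
    and A: "A \<subseteq> centralizer G h" "\<And>a b. a \<in> A \<Longrightarrow> b \<in> A \<Longrightarrow> a \<otimes> b = b \<otimes> a"
    and T: "T \<subseteq> carrier G" "\<And>x. x \<in> carrier G \<Longrightarrow> \<exists>t\<in>T. \<exists>a\<in>A. x = t \<otimes> a"
  shows "CARD('d) \<le> card T"
proof -
  obtain v c where "v \<noteq> 0" "P h v = v" "\<And>a. a \<in> A \<Longrightarrow> E a v = c a *s v"
    using E_eigenvector[OF A h u] by metis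
  moreover have "A \<subseteq> carrier G" using A(1) by (auto simp: centralizer_def)
  ultimately have "vec.span ((\<lambda>t. E t v) ` T) = UNIV"
    using translates_span[OF h _ _ _ _ T] by blast
  moreover have "finite T" using T(1) fin finite_subset by blast
  ultimately have "vec.dim (UNIV :: (complex ^ 'd) set) \<le> card ((\<lambda>t. E t v) ` T)"
    by (intro vec.dim_le_card) auto
  also have "\<dots> \<le> card T" using \<open>finite T\<close> by (rule card_image_le)
  finally show ?thesis unfolding vec_dim_card .
qed

text \<open>The translates of a vector of weight \<open>h\<close> have the conjugates of \<open>h\<close> as weights, and
  vectors of different weights are independent.\<close>

lemma card_conj_class_le:
  assumes h: "h \<in> carrier G" and v: "v \<noteq> 0" "P h v = v"
  shows "card (conj_class G h) \<le> CARD('d)"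
proof -
  have "\<exists>w. w \<noteq> 0 \<and> P k w = w" if k: "k \<in> conj_class G h" for k
  proof -
    obtain g where g: "g \<in> carrier G" "k = g \<otimes> h \<otimes> inv g"
      using k by (auto simp: conj_class_def)
    have "k \<in> carrier G" "inv g \<otimes> k \<otimes> g = h"
      unfolding g(2) using g(1) h by (simp_all add: m_assoc inv_cancel)
    then have "P k (E g v) = E g v" using P_E[of g k v] g(1) v by simp
    moreover have "E g v \<noteq> 0" using E_inj g v by blast
    ultimately show ?thesis by blast
  qed
  then obtain w where w: "\<And>k. k \<in> conj_class G h \<Longrightarrow> w k \<noteq> 0 \<and> P k (w k) = w k" by metis
  have C: "conj_class G h \<subseteq> carrier G" using h by (auto simp: conj_class_def)
  have finC: "finite (conj_class G h)" using C fin finite_subset by blast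
  have P_w: "P k (w l) = (if k = l then w l else 0)"
    if "k \<in> conj_class G h" "l \<in> conj_class G h" for k l
    using that w[of l] P_P[of k l "w l"] C[THEN subsetD] by simp
  have inj: "inj_on w (conj_class G h)" using P_w w by (metis inj_onI)
  have "vec.independent (w ` conj_class G h)"
  proof
    assume "vec.dependent (w ` conj_class G h)"
    then obtain a where a: "(\<Sum>k\<in>conj_class G h. a (w k) *s w k) = 0"
      and nz: "\<exists>k\<in>conj_class G h. a (w k) \<noteq> 0"
      using finC inj by (auto simp: vec.dependent_finite sum.reindex)
    obtain l where l: "l \<in> conj_class G h" "a (w l) \<noteq> 0" using nz by blast
    interpret p: Vector_Spaces.linear "(*s)" "(*s)" "P l" using l C by (auto intro: linear_P)
    have "0 = P l (\<Sum>k\<in>conj_class G h. a (w k) *s w k)" by (simp add: a p.zero)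
    also have "\<dots> = (\<Sum>k\<in>conj_class G h. if k = l then a (w l) *s w l else 0)"
      unfolding p.sum by (rule sum.cong) (auto simp: p.scale P_w l)
    also have "\<dots> = a (w l) *s w l" using finC l by simp
    finally show False using l w by simp
  qed
  then have "card (w ` conj_class G h) \<le> vec.dim (UNIV :: (complex ^ 'd) set)"
    by (intro vec.independent_card_le_dim) auto
  then show ?thesis unfolding vec_dim_card by (simp add: card_image inj)
qed

text \<open>With \<open>A\<close> the full centralizer of \<open>h\<close>, the cosets of \<open>A\<close> correspond to the conjugates of
  \<open>h\<close>, so the upper and the lower bound agree.\<close>

theorem dimension_eq_card_conj_class:
  assumes h: "h \<in> carrier G" and u: "u \<noteq> 0" "P h u = u"
    and comm: "\<And>a b. a \<in> centralizer G h \<Longrightarrow> b \<in> centralizer G h \<Longrightarrow> a \<otimes> b = b \<otimes> a"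
  shows "CARD('d) = card (conj_class G h)"
proof (rule antisym)
  have "\<exists>t. t \<in> carrier G \<and> k = t \<otimes> h \<otimes> inv t" if "k \<in> conj_class G h" for k
    using that unfolding conj_class_def by blast
  then obtain t where t: "\<And>k. k \<in> conj_class G h \<Longrightarrow> t k \<in> carrier G \<and> k = t k \<otimes> h \<otimes> inv (t k)"
    by metis
  have finC: "finite (conj_class G h)" using fin by (simp add: conj_class_def)
  have "CARD('d) \<le> card (t ` conj_class G h)"
  proof (rule dimension_le[OF h u subset_refl comm])
    fix x assume x: "x \<in> carrier G"
    then have "x \<otimes> h \<otimes> inv x \<in> conj_class G h" by (auto simp: conj_class_def)
    with t obtain r where r: "r \<in> t ` conj_class G h" "r \<in> carrier G"
      and conj: "x \<otimes> h \<otimes> inv x = r \<otimes> h \<otimes> inv r"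
      by blast
    have "inv r \<otimes> x \<otimes> h = inv r \<otimes> (x \<otimes> h \<otimes> inv x) \<otimes> x"
      using r x h by (simp add: m_assoc)
    also have "\<dots> = h \<otimes> (inv r \<otimes> x)"
      unfolding conj using r x h by (simp add: m_assoc inv_cancel)
    finally have "inv r \<otimes> x \<in> centralizer G h"
      using r x h by (simp add: centralizer_def)
    moreover have "x = r \<otimes> (inv r \<otimes> x)" using r x by (simp add: inv_cancel)
    ultimately show "\<exists>r\<in>t ` conj_class G h. \<exists>a\<in>centralizer G h. x = r \<otimes> a" using r by blast
  qed (use t in auto)
  also have "\<dots> \<le> card (conj_class G h)" using finC by (rule card_image_le)
  finally show "CARD('d) \<le> card (conj_class G h)" .
qed (rule card_conj_class_le[OF h u])

end

text \<open>The algebra acts on the span of a conjugacy class: \<open>g\<close> by conjugation, and \<open>h\<^sup>*\<close> as the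
  projection onto the line of \<open>h\<close>. This corresponds to the trivial character of the
  centralizer.\<close>

theorem conj_class_representation:
  fixes G :: "('a, 'm) monoid_scheme" (structure)
  assumes "group G" and fin: "finite (carrier G)" and h: "h \<in> carrier G"
    and card: "card (conj_class G h) = CARD('d)"
  shows "\<exists>\<rho> :: ('a \<times> 'a \<Rightarrow> complex) \<Rightarrow> complex ^ 'd \<Rightarrow> complex ^ 'd.
    irreducible_representation (quantum_double G) \<rho>"
proof -
  interpret group G by fact
  let ?Q = "quantum_double G" and ?C = "conj_class G h"
  have C: "?C \<subseteq> carrier G" using h by (auto simp: conj_class_def)
  have "finite ?C" using C fin finite_subset by blast
  then obtain b where b: "bij_betw b (UNIV :: 'd set) ?C"
    using finite_same_card_bij[of "UNIV :: 'd set" ?C] card by auto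
  have b_C: "b i \<in> ?C" for i using b by (auto simp: bij_betw_def)
  have b_carr [simp]: "b i \<in> carrier G" for i using b_C C by blast
  have b_inj: "b i = b j \<longleftrightarrow> i = j" for i j using b by (auto simp: bij_betw_def inj_eq)
  have "\<exists>j. b j = inv g \<otimes> b i \<otimes> g" if g: "g \<in> carrier G" for g i
  proof -
    obtain k where k: "k \<in> carrier G" "b i = k \<otimes> h \<otimes> inv k"
      using b_C[of i] unfolding conj_class_def by blast
    have "inv g \<otimes> b i \<otimes> g = (inv g \<otimes> k) \<otimes> h \<otimes> inv (inv g \<otimes> k)"
      using g k(1) h unfolding k(2) by (simp add: m_assoc inv_mult_group)
    then have "inv g \<otimes> b i \<otimes> g \<in> ?C" using g k by (auto simp: conj_class_def)
    then show ?thesis using b by (metis bij_betw_imp_surj_on imageE)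
  qed
  then obtain act where act: "\<And>g i. g \<in> carrier G \<Longrightarrow> b (act g i) = inv g \<otimes> b i \<otimes> g"
    by metis
  have act_mult: "act (g \<otimes> k) i = act k (act g i)" if "g \<in> carrier G" "k \<in> carrier G" for g k i
    using that by (subst b_inj[symmetric]) (simp add: act m_assoc inv_mult_group)
  have act_one: "act \<one> i = i" for i by (subst b_inj[symmetric]) (simp add: act)
  have act_inj: "act g i = act g j \<longleftrightarrow> i = j" if "g \<in> carrier G" for g i j
    using act_mult[of g "inv g"] that by (metis act_one inv_closed r_inv)
  have act_trans: "\<exists>g\<in>carrier G. act g i = j" for i j
  proof -
    obtain k l where k: "k \<in> carrier G" "b i = k \<otimes> h \<otimes> inv k"
      and l: "l \<in> carrier G" "b j = l \<otimes> h \<otimes> inv l"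
      using b_C[of i] b_C[of j] unfolding conj_class_def by blast
    have "b (act (k \<otimes> inv l) i) = b j"
      using k(1) l(1) h by (simp add: act k(2) l(2) m_assoc inv_mult_group inv_cancel)
    then show ?thesis using k l b_inj by blast
  qed
  \<comment> \<open>With the coordinate \<open>i\<close> standing for the class element \<open>b i\<close>, the action of \<open>g\<close> moves the
    coordinate at \<open>g\<^bsup>-1\<^esup> (b i) g\<close> to \<open>b i\<close>; hence \<open>act\<close> is a right action.\<close>
  define \<rho> :: "('a \<times> 'a \<Rightarrow> complex) \<Rightarrow> complex ^ 'd \<Rightarrow> complex ^ 'd" where
    "\<rho> a v = (\<chi> i. \<Sum>g\<in>carrier G. a (g, b (act g i)) * v $ act g i)" for a v
  have rho_mult: "\<rho> (a \<otimes>\<^bsub>?Q\<^esub> c) v = \<rho> a (\<rho> c v)" for a c v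
  proof (rule vec_eq_iff[THEN iffD2, rule_format])
    fix i
    have "\<rho> (a \<otimes>\<^bsub>?Q\<^esub> c) v $ i = (\<Sum>k\<in>carrier G. \<Sum>x\<in>carrier G.
        a (x \<otimes> inv k, k \<otimes> b (act x i) \<otimes> inv k) * c (k, b (act x i)) * v $ act x i)"
      by (subst sum.swap) (simp add: \<rho>_def qd_mult_apply[OF is_group fin] sum_distrib_right)
    also have "\<dots> = (\<Sum>k\<in>carrier G. \<Sum>g\<in>carrier G.
        a (g, b (act g i)) * c (k, b (act k (act g i))) * v $ act k (act g i))"
    proof (rule sum.cong[OF refl])
      fix k assume k: "k \<in> carrier G"
      have conj: "k \<otimes> (b (act x i) \<otimes> inv k) = b (act (x \<otimes> inv k) i)" if "x \<in> carrier G" for x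
        using that k by (simp add: act m_assoc inv_mult_group)
      show "(\<Sum>x\<in>carrier G.
          a (x \<otimes> inv k, k \<otimes> b (act x i) \<otimes> inv k) * c (k, b (act x i)) * v $ act x i) =
        (\<Sum>g\<in>carrier G. a (g, b (act g i)) * c (k, b (act k (act g i))) * v $ act k (act g i))"
        by (rule sum.reindex_bij_witness
              [where i = "\<lambda>g. g \<otimes> k" and j = "\<lambda>x. x \<otimes> inv k"])
          (use k conj in \<open>auto simp: m_assoc simp flip: act_mult\<close>)
    qed
    also have "\<dots> = \<rho> a (\<rho> c v) $ i"
      by (subst sum.swap) (simp add: \<rho>_def sum_distrib_left mult.assoc)
    finally show "\<rho> (a \<otimes>\<^bsub>?Q\<^esub> c) v $ i = \<rho> a (\<rho> c v) $ i" .
  qed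
  have rho_one: "\<rho> \<one>\<^bsub>?Q\<^esub> v = v" for v
  proof (rule vec_eq_iff[THEN iffD2, rule_format])
    fix i
    have "\<rho> \<one>\<^bsub>?Q\<^esub> v $ i = (\<Sum>g\<in>carrier G. if g = \<one> then v $ i else 0)"
      unfolding \<rho>_def qd_one vec_lambda_beta
      by (rule sum.cong) (auto simp: qd_elem_apply[OF fin] act_one)
    then show "\<rho> \<one>\<^bsub>?Q\<^esub> v $ i = v $ i" using fin by simp
  qed
  have "algebra_representation ?Q \<rho>"
    unfolding algebra_representation_def Vector_Spaces.linear_iff
    by (auto simp: fun_eq_iff rho_mult rho_one vec.vector_space_axioms)
      (auto simp: \<rho>_def vec_eq_iff quantum_double_def sum.distrib sum_distrib_left algebra_simps)
  moreover have "W = {0} \<or> W = UNIV"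
    if W: "vec.subspace W" and inv: "\<forall>a\<in>carrier ?Q. \<rho> a ` W \<subseteq> W" for W
  proof (cases "W = {0}")
    case False
    then obtain w where "w \<in> W" "w \<noteq> 0" using W vec.subspace_0 by blast
    then obtain j where w: "w \<in> W" "w $ j \<noteq> 0" by (auto simp: vec_eq_iff)
    \<comment> \<open>The basis element \<open>g (b j)\<^sup>*\<close> isolates the coordinate \<open>j\<close> of \<open>w\<close> and moves it to \<open>i\<close>.\<close>
    have "axis i 1 \<in> W" for i
    proof -
      obtain g where g: "g \<in> carrier G" "act g i = j" using act_trans by blast
      have "\<rho> (qd_basis g (b j)) w = w $ j *s axis i 1"
      proof (rule vec_eq_iff[THEN iffD2, rule_format])
        fix l
        have "\<rho> (qd_basis g (b j)) w $ l =
            (\<Sum>k\<in>carrier G. if k = g then if l = i then w $ j else 0 else 0)"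
          unfolding \<rho>_def vec_lambda_beta
          by (rule sum.cong) (use g act_inj b_inj in \<open>auto simp: qd_basis_def\<close>)
        then show "\<rho> (qd_basis g (b j)) w $ l = (w $ j *s axis i 1) $ l"
          using fin g by (simp add: axis_def)
      qed
      moreover have "qd_basis g (b j) \<in> carrier ?Q"
        using g by (auto simp: quantum_double_def qd_basis_def)
      ultimately have "w $ j *s axis i 1 \<in> W" using inv w by (metis image_subset_iff)
      then have "inverse (w $ j) *s (w $ j *s axis i 1) \<in> W" by (rule vec.subspace_scale[OF W])
      then show ?thesis using w by simp
    qed
    then have "(\<Sum>i\<in>UNIV. x $ i *s axis i 1) \<in> W" for x
      using W by (intro vec.subspace_sum vec.subspace_scale)
    then show ?thesis by (auto simp: basis_expansion)
  qed auto
  ultimately show ?thesis unfolding irreducible_representation_def by blast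
qed

section \<open>Conjugation in dihedral groups\<close>

lemma dihedral_mult:
  "(i, s) \<otimes>\<^bsub>dihedral_group n\<^esub> (k, t) = ((if s then i - k else i + k) mod int n, s \<noteq> t)"
  by (simp add: dihedral_group_def)

lemma dihedral_carrier: "x \<in> carrier (dihedral_group n) \<longleftrightarrow> 0 \<le> fst x \<and> fst x < int n"
  by (cases x) (auto simp: dihedral_group_def)

lemma dihedral_inv:
  assumes "n > 0" "(i, s) \<in> carrier (dihedral_group n)"
  shows "inv\<^bsub>dihedral_group n\<^esub> (i, s) = (if s then i else (- i) mod int n, s)"
proof -
  interpret group "dihedral_group n" by (rule group_dihedral_group[OF assms(1)])
  show ?thesis
    by (rule inv_equality) (use assms in \<open>auto simp: dihedral_group_def mod_simps\<close>)
qed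

text \<open>A rotation by \<open>j\<close> commutes with the reflection at \<open>i\<close> iff \<open>2 j \<equiv> 0\<close>, and the reflection at
  \<open>j\<close> does iff \<open>2 j \<equiv> 2 i\<close> modulo \<open>n\<close>. These congruences make any two such elements commute.\<close>

lemma centralizer_reflection_commute:
  assumes "a \<in> centralizer (dihedral_group n) (i, True)"
    and "b \<in> centralizer (dihedral_group n) (i, True)"
  shows "a \<otimes>\<^bsub>dihedral_group n\<^esub> b = b \<otimes>\<^bsub>dihedral_group n\<^esub> a"
proof -
  obtain j s k t where ab: "a = (j, s)" "b = (k, t)" by fastforce
  have j: "int n dvd (if s then 2 * j - 2 * i else 2 * j)"
    and k: "int n dvd (if t then 2 * k - 2 * i else 2 * k)"
    using assms
    by (auto simp: ab centralizer_def dihedral_mult mod_eq_dvd_iff algebra_simps split: if_splits)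
  have "int n dvd (if s then j - k else j + k) - (if t then k - j else k + j)"
    using j k dvd_diff[OF j k] by (cases s; cases t) (simp_all add: algebra_simps)
  then show ?thesis by (auto simp: ab dihedral_mult mod_eq_dvd_iff)
qed

text \<open>Conjugation shifts the index of a reflection by arbitrary even amounts. Modulo \<open>n\<close> these
  run through all residues if \<open>n\<close> is odd, and through half of them if \<open>n\<close> is even.\<close>

lemma card_conj_class_reflection:
  assumes n: "n > 0" and i: "(i, True) \<in> carrier (dihedral_group n)"
  shows "card (conj_class (dihedral_group n) (i, True)) = (if even n then n div 2 else n)"
proof -
  define m where "m = (if even n then n div 2 else n)"
  have m: "int n dvd 2 * x \<longleftrightarrow> int m dvd x" for x
  proof (cases "even n")
    case True
    then have "int n = 2 * int m" by (auto simp: m_def)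
    then show ?thesis by simp
  next
    case False
    then have "coprime (int n) 2" by simp
    then show ?thesis using False by (simp add: m_def coprime_dvd_mult_right_iff)
  qed
  have "m > 0" using n by (auto simp: m_def elim: evenE)
  let ?f = "\<lambda>k. ((i + 2 * k) mod int n, True)"
  have f_eq: "?f k = ?f l \<longleftrightarrow> int m dvd k - l" for k l
    using m[of "k - l"] by (simp add: mod_eq_dvd_iff algebra_simps)
  have conj: "g \<otimes>\<^bsub>dihedral_group n\<^esub> (i, True) \<otimes>\<^bsub>dihedral_group n\<^esub> inv\<^bsub>dihedral_group n\<^esub> g =
      ?f (if snd g then fst g - i else fst g)" if "g \<in> carrier (dihedral_group n)" for g
    using that n
    by (cases g) (auto simp: dihedral_inv dihedral_mult mod_simps algebra_simps)
  have "conj_class (dihedral_group n) (i, True) = ?f ` {0..<int m}"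
  proof (intro equalityI subsetI)
    fix x assume "x \<in> conj_class (dihedral_group n) (i, True)"
    then obtain k where "x = ?f k" unfolding conj_class_def using conj by blast
    also have "\<dots> = ?f (k mod int m)" by (subst f_eq) (simp add: minus_mod_eq_mult_div)
    finally show "x \<in> ?f ` {0..<int m}" using \<open>m > 0\<close> by simp
  next
    fix x assume "x \<in> ?f ` {0..<int m}"
    then obtain k where k: "0 \<le> k" "k < int m" "x = ?f k" by auto
    have "m \<le> n" by (simp add: m_def)
    with k have "(k, False) \<in> carrier (dihedral_group n)" by (simp add: dihedral_carrier)
    with conj k show "x \<in> conj_class (dihedral_group n) (i, True)"
      unfolding conj_class_def by (force intro!: image_eqI[where x = "(k, False)"])
  qed
  moreover have "inj_on ?f {0..<int m}"
    by (rule inj_onI, unfold f_eq) (auto simp flip: mod_eq_dvd_iff)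
  ultimately show ?thesis by (simp add: card_image m_def)
qed

section \<open>Representations of dimension three\<close>

theorem mainTheorem4:
  fixes n :: nat
  assumes "n > 0"
  shows "(\<exists>\<rho> :: (((int \<times> bool) \<times> (int \<times> bool)) \<Rightarrow> complex) \<Rightarrow> complex ^ 3 \<Rightarrow> complex ^ 3.
            irreducible_representation (quantum_double (dihedral_group n)) \<rho>)
         \<longleftrightarrow> n = 3 \<or> n = 6"
proof
  let ?D = "dihedral_group n"
  interpret group ?D by (rule group_dihedral_group[OF assms])
  assume "\<exists>\<rho> :: (((int \<times> bool) \<times> (int \<times> bool)) \<Rightarrow> complex) \<Rightarrow> complex ^ 3 \<Rightarrow> complex ^ 3.
    irreducible_representation (quantum_double ?D) \<rho>"
  then obtain \<rho> :: "(((int \<times> bool) \<times> (int \<times> bool)) \<Rightarrow> complex) \<Rightarrow> complex ^ 3 \<Rightarrow> complex ^ 3"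
    where "irreducible_representation (quantum_double ?D) \<rho>" by blast
  then interpret irreducible_double ?D \<rho>
    by unfold_locales (rule finite_dihedral_group)
  obtain h v where h: "h \<in> carrier ?D" and v: "v \<noteq> 0" "P h v = v" using weight_exists by blast
  show "n = 3 \<or> n = 6"
  proof (cases "snd h")
    case True
    then obtain i where i: "h = (i, True)" by (cases h) auto
    have "CARD(3) = card (conj_class ?D h)"
      using dimension_eq_card_conj_class[OF h v] centralizer_reflection_commute i by blast
    also have "\<dots> = (if even n then n div 2 else n)"
      using card_conj_class_reflection[OF assms] h i by blast
    finally show ?thesis by (auto split: if_splits elim!: evenE)
  next
    case False
    then obtain i where i: "h = (i, False)" by (cases h) auto
    let ?R = "{g \<in> carrier ?D. \<not> snd g}" and ?T = "{(0, False), (0, True)} :: (int \<times> bool) set"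
    have "CARD(3) \<le> card ?T"
    proof (rule dimension_le[OF h v])
      show "?R \<subseteq> centralizer ?D h"
        by (auto simp: i centralizer_def dihedral_mult add.commute)
      show "a \<otimes>\<^bsub>?D\<^esub> b = b \<otimes>\<^bsub>?D\<^esub> a" if "a \<in> ?R" "b \<in> ?R" for a b
        using that by (cases a; cases b) (auto simp: dihedral_mult add.commute)
      show "?T \<subseteq> carrier ?D" using assms by (auto simp: dihedral_carrier)
      show "\<exists>t\<in>?T. \<exists>a\<in>?R. x = t \<otimes>\<^bsub>?D\<^esub> a" if x: "x \<in> carrier ?D" for x
      proof -
        obtain j s where js: "x = (j, s)" by fastforce
        have "x = (0, s) \<otimes>\<^bsub>?D\<^esub> ((if s then - j else j) mod int n, False)"
          using x by (simp add: js dihedral_mult dihedral_carrier mod_simps)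
        moreover have "((if s then - j else j) mod int n, False) \<in> ?R"
          using assms by (simp add: dihedral_carrier)
        moreover have "(0, s) \<in> ?T" by simp
        ultimately show ?thesis by blast
      qed
    qed
    then show ?thesis by simp
  qed
next
  assume n: "n = 3 \<or> n = 6"
  have tau: "(0, True) \<in> carrier (dihedral_group n)" using assms by (simp add: dihedral_carrier)
  have "card (conj_class (dihedral_group n) (0, True)) = CARD(3)"
    using card_conj_class_reflection[OF assms tau] n by auto
  then show "\<exists>\<rho> :: (((int \<times> bool) \<times> (int \<times> bool)) \<Rightarrow> complex) \<Rightarrow> complex ^ 3 \<Rightarrow> complex ^ 3.
    irreducible_representation (quantum_double (dihedral_group n)) \<rho>"
    using conj_class_representation[OF group_dihedral_group[OF assms] finite_dihedral_group tau]
    by blast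
qed

end
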